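(* Let $B_P$ be a basis matrix of a number lattice, with rows $b_1,\dots,b_m$ and Gram–Schmidt orthogonalization $b_1^*,\dots,b_m^*$, $b_i^*=b_i-\sum_{j<i}\alpha_{ij}b_j^*$, $\alpha_{ij}=\langle b_i,b_j^*\rangle/\langle b_j^*,b_j^*\rangle$. Let $B_P^{(2+)}$ be the unique matrix with $\mathrm{row}(B_P^{(2+)})=\mathrm{row}(B_P)$ and $B_P(B_P^{(2+)})^T=I_m$, and let $B_P^{(2)}$ be obtained from $B_P^{(2+)}$ by reversing the order of its rows. Let $\delta\in(\tfrac14,1)$. 1. If $B_P$ satisfies the size reduction condition ($|\alpha_{ij}|\le\tfrac12$ for all $j<i$), then the Gram–Schmidt coefficients $\alpha'_{ij}$ of $B_P^{(2)}$ satisfy $|\alpha'_{(i+1)i}|\le\tfrac12$ for $i=1,\dots,m-1$. 2. If $B_P$ satisfies the Lovász condition with parameter $\delta$ with respect to its Gram–Schmidt orthogonalization, i.e. $\alpha_{(i+1)i}^2\|b_i^*\|^2+\|b_{i+1}^*\|^2\ge\delta\|b_i^*\|^2$ for $i=1,\dots,m-1$, then $B_P^{(2)}$ satisfies the Lovász condition with parameter $\delta$ with respect to its own Gram–Schmidt orthogonalization.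
   Context: Vectors are over $\mathbb{Q}$ and written as rows; $\mathrm{row}(A)$ is the row space of $A$; $\|\cdot\|$ is the Euclidean norm. A basis matrix of a number lattice is a matrix with linearly independent rows generating the lattice by integer combinations. The Gram–Schmidt orthogonalization of a matrix with linearly independent rows $c_1,\dots,c_m$ is $c_1^*=c_1$, $c_i^*=c_i-\sum_{j<i}\gamma_{ij}c_j^*$ with $\gamma_{ij}=\langle c_i,c_j^*\rangle/\langle c_j^*,c_j^*\rangle$; the Lovász condition with parameter $\delta$ is $\gamma_{(i+1)i}^2\|c_i^*\|^2+\|c_{i+1}^*\|^2\ge\delta\|c_i^*\|^2$ for all $i$. *)

theory Defs
  imports "Jordan_Normal_Form.Gram_Schmidt" "Jordan_Normal_Form.DL_Rank"
begin

text \<open>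
  Vectors over \<open>\<rat>\<close> are rows of matrices of type \<^typ>\<open>rat mat\<close>.  Rows are indexed from \<open>0\<close>,
  so the informal index \<open>i\<close> corresponds to \<open>i - 1\<close> here.
\<close>

abbreviation row_sp :: "rat mat \<Rightarrow> rat vec set" where
  "row_sp A \<equiv> vec_space.row_space (dim_col A) A"

text \<open>\<^term>\<open>distinct (rows B)\<close> is needed because \<open>lin_dep\<close> is a predicate on sets of vectors.\<close>

definition lin_indep_rows :: "rat mat \<Rightarrow> bool" where
  "lin_indep_rows B \<longleftrightarrow> distinct (rows B) \<and>
     \<not> module.lin_dep class_ring (module_vec TYPE(rat) (dim_col B)) (set (rows B))"

definition basis_matrix :: "rat mat \<Rightarrow> rat vec set \<Rightarrow> bool" where
  "basis_matrix B L \<longleftrightarrow>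
     lin_indep_rows B \<and> L = vec_module.lattice_of (dim_col B) (rows B)"

definition euclid_norm :: "rat vec \<Rightarrow> real" where
  "euclid_norm v = sqrt (of_rat (v \<bullet> v))"

definition gs_vec :: "rat mat \<Rightarrow> nat \<Rightarrow> rat vec" where
  "gs_vec C i = gram_schmidt (dim_col C) (rows C) ! i"

definition gs_coeff :: "rat mat \<Rightarrow> nat \<Rightarrow> nat \<Rightarrow> rat" where
  "gs_coeff C i j = (row C i \<bullet> gs_vec C j) / (gs_vec C j \<bullet> gs_vec C j)"

definition size_reduced :: "rat mat \<Rightarrow> bool" where
  "size_reduced C \<longleftrightarrow> (\<forall>i j. j < i \<and> i < dim_row C \<longrightarrow> \<bar>gs_coeff C i j\<bar> \<le> 1 / 2)"

definition lovasz :: "real \<Rightarrow> rat mat \<Rightarrow> bool" where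
  "lovasz \<delta> C \<longleftrightarrow> (\<forall>i. i + 1 < dim_row C \<longrightarrow>
     (of_rat (gs_coeff C (i + 1) i))\<^sup>2 * (euclid_norm (gs_vec C i))\<^sup>2
       + (euclid_norm (gs_vec C (i + 1)))\<^sup>2
     \<ge> \<delta> * (euclid_norm (gs_vec C i))\<^sup>2)"

text \<open>
  The carrier condition excludes matrices of the wrong shape, for which the product is
  unspecified.  Existence and uniqueness are \<open>dual_ex1\<close> below.
\<close>

definition dual_matrix :: "rat mat \<Rightarrow> rat mat" where
  "dual_matrix B = (THE D. D \<in> carrier_mat (dim_row B) (dim_col B) \<and>
     row_sp D = row_sp B \<and> B * transpose_mat D = 1\<^sub>m (dim_row B))"

definition reverse_rows :: "rat mat \<Rightarrow> rat mat" where
  "reverse_rows A = mat_of_rows (dim_col A) (rev (rows A))"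

text \<open>\<open>gs_vec\<close> obeys the textbook recursion.\<close>

lemma gram_schmidt_sub2_nth:
  "i < length ws \<Longrightarrow> gram_schmidt_sub2 n us ws ! i =
     adjuster n (ws ! i) (rev (take i (gram_schmidt_sub2 n us ws)) @ us) + ws ! i"
proof (induction ws arbitrary: us i)
  case (Cons w ws)
  then show ?case by (cases i) (auto simp: Let_def)
qed simp

lemma adjuster_nth:
  assumes "set us \<subseteq> carrier_vec n" "k < n"
  shows "adjuster n w us $ k =
    - (\<Sum>j<length us. (w \<bullet>c us ! j) / (us ! j \<bullet>c us ! j) * us ! j $ k) \<and>
    dim_vec (adjuster n w us) = n"
  using assms
proof (induction us)
  case (Cons u us)
  then show ?case by (auto simp: sum.lessThan_Suc_shift simp del: sum.lessThan_Suc)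
qed simp

lemma gram_schmidt_sub2_carrier:
  "set ws \<subseteq> carrier_vec n \<Longrightarrow> set (gram_schmidt_sub2 n us ws) \<subseteq> carrier_vec n"
  by (induction ws arbitrary: us) (auto simp: Let_def intro!: carrier_vecI)

lemma gram_schmidt_sub2_length: "length (gram_schmidt_sub2 n us ws) = length ws"
  by (induction ws arbitrary: us) (auto simp: Let_def)

lemma conjugate_rat_vec [simp]: "conjugate (v :: rat vec) = v"
  by (rule eq_vecI) (auto simp: conjugate_rat_def)

lemma gs_vec_carrier: "i < dim_row C \<Longrightarrow> gs_vec C i \<in> carrier_vec (dim_col C)"
  using gram_schmidt_sub2_carrier[of "rows C" "dim_col C" "[]"] rows_carrier[of C]
  unfolding gs_vec_def gram_schmidt_code
  by (metis gram_schmidt_sub2_length length_rows nth_mem subset_eq)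

lemma gs_vec_rec:
  assumes i: "i < dim_row C" and k: "k < dim_col C"
  shows "gs_vec C i $ k = row C i $ k - (\<Sum>j<i. gs_coeff C i j * gs_vec C j $ k)"
proof -
  let ?n = "dim_col C" and ?g = "gram_schmidt_sub2 (dim_col C) [] (rows C)"
  let ?us = "rev (take i ?g)"
  have len: "length ?us = i" using i by (simp add: gram_schmidt_sub2_length)
  have us: "set ?us \<subseteq> carrier_vec ?n"
    using gram_schmidt_sub2_carrier[of "rows C" "dim_col C" "[]"] rows_carrier[of C]
      set_take_subset[of i ?g] by auto
  have nth: "?us ! j = gs_vec C (i - Suc j)" if "j < i" for j
    using that len i unfolding gs_vec_def gram_schmidt_code
    by (simp add: rev_nth gram_schmidt_sub2_length)
  have "gs_vec C i = adjuster ?n (row C i) ?us + row C i"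
    using gram_schmidt_sub2_nth[of i "rows C" ?n "[]"] i
    unfolding gs_vec_def gram_schmidt_code by simp
  hence "gs_vec C i $ k = row C i $ k -
      (\<Sum>j<i. (row C i \<bullet> ?us ! j) / (?us ! j \<bullet> ?us ! j) * ?us ! j $ k)"
    using adjuster_nth[OF us k, of "row C i"] k unfolding len by simp
  also have "(\<Sum>j<i. (row C i \<bullet> ?us ! j) / (?us ! j \<bullet> ?us ! j) * ?us ! j $ k)
      = (\<Sum>j<i. gs_coeff C i (i - Suc j) * gs_vec C (i - Suc j) $ k)"
    by (rule sum.cong) (auto simp: nth gs_coeff_def)
  also have "\<dots> = (\<Sum>j<i. gs_coeff C i j * gs_vec C j $ k)"
    by (rule sum.nat_diff_reindex)
  finally show ?thesis .
qed

lemma gram_matrix_inj: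
  assumes B: "B \<in> carrier_mat m n" and ind: "lin_indep_rows B"
    and v: "v \<in> carrier_vec m" and z: "B *\<^sub>v (transpose_mat B *\<^sub>v v) = 0\<^sub>v m"
  shows "v = 0\<^sub>v m"
proof (rule ccontr)
  assume nz: "v \<noteq> 0\<^sub>v m"
  interpret vec_space "TYPE(rat)" n .
  have Bt: "transpose_mat B \<in> carrier_mat n m" using B by auto
  let ?w = "transpose_mat B *\<^sub>v v"
  have w: "?w \<in> carrier_vec n" using Bt v by auto
  have "?w \<bullet> ?w = v \<bullet> (B *\<^sub>v ?w)"
    using transpose_vec_mult_scalar[OF B w v] by simp
  also have "\<dots> = 0" using z v by simp
  finally have "?w = 0\<^sub>v n"
    using conjugate_square_eq_0_vec[OF w] by simp
  moreover have "distinct (cols (transpose_mat B))" "\<not> lin_dep (set (cols (transpose_mat B)))"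
    using ind B unfolding lin_indep_rows_def by auto
  ultimately show False
    using lin_depI[OF Bt v nz] by blast
qed

lemma dual_ex1:
  assumes ind: "lin_indep_rows B"
  shows "\<exists>!D. D \<in> carrier_mat (dim_row B) (dim_col B) \<and>
     row_sp D = row_sp B \<and> B * transpose_mat D = 1\<^sub>m (dim_row B)"
proof -
  define m n where "m = dim_row B" and "n = dim_col B"
  interpret vec_space "TYPE(rat)" n .
  have B: "B \<in> carrier_mat m n" by (auto simp: m_def n_def)
  have Bt: "transpose_mat B \<in> carrier_mat n m" using B by auto
  define G where "G = B * transpose_mat B"
  have G: "G \<in> carrier_mat m m" using B by (auto simp: G_def)
  have Gt: "transpose_mat G = G" unfolding G_def by (subst transpose_mult[OF B Bt]) simp
  have "det G \<noteq> 0"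
    using gram_matrix_inj[OF B ind] assoc_mult_mat_vec[OF B Bt]
    unfolding det_0_iff_vec_prod_zero[OF G] by (auto simp: G_def)
  then obtain P where P: "P \<in> carrier_mat m m" and PG: "P * G = 1\<^sub>m m" and GP: "G * P = 1\<^sub>m m"
    using det_non_zero_imp_unit[OF G] unfolding Units_def ring_mat_def by auto
  have invP: "invertible_mat P"
    using P G PG GP unfolding invertible_mat_def inverts_mat_def by auto
  have PB: "P * B \<in> carrier_mat m n" using P B by auto
  have ex: "P * B \<in> carrier_mat m n \<and> row_space (P * B) = row_space B \<and>
      B * transpose_mat (P * B) = 1\<^sub>m m"
  proof (intro conjI)
    show "row_space (P * B) = row_space B" by (rule row_space_is_preserved[OF invP P B])
    have "B * transpose_mat (P * B) = G * transpose_mat P"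
      using P unfolding transpose_mult[OF P B] G_def
      by (subst assoc_mult_mat[OF B Bt]) auto
    also have "\<dots> = transpose_mat (P * G)"
      using transpose_mult[OF P G] Gt by simp
    finally show "B * transpose_mat (P * B) = 1\<^sub>m m" using PG by simp
  qed (use PB in auto)
  have uniq: "D = E"
    if D: "D \<in> carrier_mat m n" "row_space D = row_space B" "B * transpose_mat D = 1\<^sub>m m"
      and E: "E \<in> carrier_mat m n" "row_space E = row_space B" "B * transpose_mat E = 1\<^sub>m m"
    for D E
  proof (rule eq_rowI)
    fix i assume "i < dim_row E"
    hence i: "i < m" using E by auto
    have *: "\<exists>y\<in>carrier_vec m. row F i = transpose_mat B *\<^sub>v y \<and> G *\<^sub>v y = col (1\<^sub>m m) i"
      if F: "F \<in> carrier_mat m n" "row_space F = row_space B" "B * transpose_mat F = 1\<^sub>m m" for F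
    proof -
      have "set (rows F) \<subseteq> carrier_vec n" using F(1) rows_carrier[of F] by auto
      moreover have "row F i \<in> set (rows F)" using i F(1) by (auto simp: rows_def)
      ultimately have "row F i \<in> row_space F"
        unfolding row_space_def using span_mem by blast
      then obtain y where y: "y \<in> carrier_vec m" "row F i = transpose_mat B *\<^sub>v y"
        unfolding F(2) row_space_eq[OF B] using B by auto
      have "G *\<^sub>v y = B *\<^sub>v row F i"
        unfolding y(2) G_def by (rule assoc_mult_mat_vec[OF B Bt y(1)])
      also have "\<dots> = B *\<^sub>v col (transpose_mat F) i" using i F(1) by simp
      also have "\<dots> = col (B * transpose_mat F) i"
        using i F(1) B by (intro eq_vecI) auto
      finally show ?thesis using y F(3) by auto
    qed
    obtain y y' where y: "y \<in> carrier_vec m" "row D i = transpose_mat B *\<^sub>v y"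
        "G *\<^sub>v y = col (1\<^sub>m m) i"
      and y': "y' \<in> carrier_vec m" "row E i = transpose_mat B *\<^sub>v y'" "G *\<^sub>v y' = col (1\<^sub>m m) i"
      using *[OF D] *[OF E] by blast
    have "P *\<^sub>v (G *\<^sub>v y) = y" "P *\<^sub>v (G *\<^sub>v y') = y'"
      using y(1) y'(1) assoc_mult_mat_vec[OF P G] PG by (metis one_mult_mat_vec)+
    hence "y = y'" using y(3) y'(3) by simp
    thus "row D i = row E i" using y(2) y'(2) by simp
  qed (use D E in auto)
  have dc: "dim_col D = n" if "D \<in> carrier_mat m n" for D :: "rat mat"
    using that by (rule carrier_matD(2))
  show ?thesis
    unfolding m_def[symmetric] n_def[symmetric]
  proof (rule ex1I)
    show "P * B \<in> carrier_mat m n \<and> vec_space.row_space (dim_col (P * B)) (P * B) = row_space B \<and>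
      B * transpose_mat (P * B) = 1\<^sub>m m"
      unfolding dc[OF PB] by (rule ex)
  next
    fix D
    assume D: "D \<in> carrier_mat m n \<and> vec_space.row_space (dim_col D) D = row_space B \<and>
      B * transpose_mat D = 1\<^sub>m m"
    hence "row_space D = row_space B" using dc[of D] by metis
    with D ex show "D = P * B" by (blast intro: uniq)
  qed
qed

end

theory Submission
  imports Defs
begin

text \<open>
  Put \<open>N\<^sub>j = \<langle>b\<^sub>j\<^sup>*, b\<^sub>j\<^sup>*\<rangle>\<close> and let \<open>d\<^sub>k\<close> be the rows of the dual matrix.  Since \<open>d\<^sub>k\<close> lies in the row
  space, it equals \<open>\<Sum>\<^sub>j \<langle>d\<^sub>k, b\<^sub>j\<^sup>*\<rangle> b\<^sub>j\<^sup>* / N\<^sub>j\<close>, and duality forces \<open>\<langle>d\<^sub>k, b\<^sub>j\<^sup>*\<rangle>\<close> to be \<open>0\<close> for \<open>j < k\<close>,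
  \<open>1\<close> for \<open>j = k\<close> and \<open>- \<alpha>\<^bsub>(k+1)k\<^esub>\<close> for \<open>j = k + 1\<close>.  So, read from the last row to the first, the vectors
  \<open>b\<^sub>j\<^sup>* / N\<^sub>j\<close> are the Gram-Schmidt orthogonalization of the reversed dual, whose subdiagonal
  coefficients are those of \<open>B\<close> up to sign, and whose Lovasz inequality is that of \<open>B\<close> divided by
  \<open>N\<^sub>k N\<^bsub>k+1\<^esub>\<close>.
\<close>

section \<open>Recognizing a Gram-Schmidt orthogonalization\<close>

text \<open>Linearity of the scalar product; the combination is given componentwise to match the
  form of \<open>gs_vec_rec\<close>.\<close>

lemma scalar_prod_expand_right:
  fixes v w :: "rat vec"
  assumes "w \<in> carrier_vec n" "\<And>j. j \<in> J \<Longrightarrow> u j \<in> carrier_vec n"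
    and "\<And>c. c < n \<Longrightarrow> w $ c = (\<Sum>j\<in>J. x j * u j $ c)"
  shows "v \<bullet> w = (\<Sum>j\<in>J. x j * (v \<bullet> u j))"
proof -
  have "v \<bullet> w = (\<Sum>c<n. \<Sum>j\<in>J. x j * (v $ c * u j $ c))"
    using assms(1,3)
    by (auto simp: scalar_prod_def atLeast0LessThan sum_distrib_left mult_ac intro!: sum.cong)
  also have "\<dots> = (\<Sum>j\<in>J. \<Sum>c<n. x j * (v $ c * u j $ c))"
    by (rule sum.swap)
  also have "\<dots> = (\<Sum>j\<in>J. x j * (v \<bullet> u j))"
    using carrier_vecD[OF assms(2)]
    by (auto simp: scalar_prod_def atLeast0LessThan sum_distrib_left intro!: sum.cong)
  finally show ?thesis .
qed

text \<open>Pairing row \<open>i\<close> with \<open>u j\<close> isolates \<open>\<beta> i j\<close>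
  by orthogonality, so by strong induction the recursion subtracts exactly the given sum and leaves
  \<open>u i\<close>. It lets an orthogonalization be identified from a guess.\<close>

lemma gs_unique:
  assumes C: "C \<in> carrier_mat m n"
    and u: "\<And>i. i < m \<Longrightarrow> u i \<in> carrier_vec n"
    and orth: "\<And>i j. i < m \<Longrightarrow> j < m \<Longrightarrow> i \<noteq> j \<Longrightarrow> u i \<bullet> u j = 0"
    and nz: "\<And>i. i < m \<Longrightarrow> u i \<bullet> u i \<noteq> 0"
    and row: "\<And>i c. i < m \<Longrightarrow> c < n \<Longrightarrow> row C i $ c = u i $ c + (\<Sum>j<i. \<beta> i j * u j $ c)"
    and i: "i < m"
  shows "gs_vec C i = u i \<and> (\<forall>j<i. gs_coeff C i j = \<beta> i j)"
  using i
proof (induction i rule: less_induct)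
  case (less i)
  have IH: "gs_vec C j = u j" if "j < i" for j
    using less that by auto
  have coeff: "gs_coeff C i j = \<beta> i j" if j: "j < i" for j
  proof -
    \<comment> \<open>The coefficient 1 at \<open>l = i\<close> absorbs the leading term
      \<open>u i\<close> into a single sum.\<close>
    define x where "x l = (if l = i then 1 else \<beta> i l)" for l
    have "u j \<bullet> row C i = (\<Sum>l\<in>{..i}. x l * (u j \<bullet> u l))"
    proof (rule scalar_prod_expand_right[where n = n])
      show "row C i \<in> carrier_vec n" using C less.prems by auto
      show "u l \<in> carrier_vec n" if "l \<in> {..i}" for l using that less.prems u by auto
      show "row C i $ c = (\<Sum>l\<in>{..i}. x l * u l $ c)" if "c < n" for c
        using row[OF less.prems that]
        by (simp add: lessThan_Suc_atMost[symmetric] x_def)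
    qed
    also have "\<dots> = (\<Sum>l\<in>{..i}. if l = j then \<beta> i j * (u j \<bullet> u j) else 0)"
      using j less.prems orth by (intro sum.cong) (auto simp: x_def)
    also have "\<dots> = \<beta> i j * (u j \<bullet> u j)"
      using j by simp
    finally have "row C i \<bullet> u j = \<beta> i j * (u j \<bullet> u j)"
      using comm_scalar_prod[of "u j" n "row C i"] u[of j] C j less.prems by auto
    thus ?thesis
      using nz[of j] j less.prems by (simp add: gs_coeff_def IH)
  qed
  have "gs_vec C i = u i"
  proof (rule eq_vecI)
    show "dim_vec (gs_vec C i) = dim_vec (u i)"
      using gs_vec_carrier[of i C] C u[of i] less.prems by auto
    fix c assume "c < dim_vec (u i)"
    hence c: "c < n" using u[of i] less.prems by auto
    have "gs_vec C i $ c = row C i $ c - (\<Sum>j<i. gs_coeff C i j * gs_vec C j $ c)"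
      using C c less.prems by (intro gs_vec_rec) auto
    also have "(\<Sum>j<i. gs_coeff C i j * gs_vec C j $ c) = (\<Sum>j<i. \<beta> i j * u j $ c)"
      by (intro sum.cong) (auto simp: IH coeff)
    finally show "gs_vec C i $ c = u i $ c"
      using row[OF less.prems c] by simp
  qed
  thus ?case using coeff by blast
qed

section \<open>Orthogonal expansion in the row space\<close>

text \<open>The equivalence also covers \<open>i = j\<close>: there it says that the squared norm is
  nonzero, which justifies the later divisions.\<close>

lemma gs_vec_orthogonal:
  assumes "lin_indep_rows B" "i < dim_row B" "j < dim_row B"
  shows "gs_vec B i \<bullet> gs_vec B j = 0 \<longleftrightarrow> i \<noteq> j"
proof -
  interpret cof_vec_space "dim_col B" "TYPE(rat)" .
  define us where "us = gram_schmidt (dim_col B) (rows B)"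
  have "corthogonal us" "length us = dim_row B"
    using gram_schmidt_result[OF _ _ _ us_def] assms(1) rows_carrier[of B]
    unfolding lin_indep_rows_def by auto
  thus ?thesis
    using corthogonalD[of us i j] assms(2,3) by (simp add: gs_vec_def us_def)
qed

lemma gs_vec_expand_row_space:
  assumes B: "B \<in> carrier_mat m n" and v: "v \<in> row_sp B"
  shows "\<exists>x. \<forall>c<n. v $ c = (\<Sum>j<m. x j * gs_vec B j $ c)"
proof -
  interpret vec_space "TYPE(rat)" n .
  obtain y where y: "y \<in> carrier_vec m" "v = transpose_mat B *\<^sub>v y"
    using v B unfolding carrier_matD(2)[OF B] row_space_eq[OF B] by auto
  \<comment> \<open>The lower unitriangular matrix that turns the orthogonalized rows back into the
    rows of \<open>B\<close>.\<close>
  define \<mu> where "\<mu> i j = (if j < i then gs_coeff B i j else if j = i then 1 else 0)" for i j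
  have row: "B $$ (i, c) = (\<Sum>j<m. \<mu> i j * gs_vec B j $ c)" if i: "i < m" and c: "c < n" for i c
  proof -
    have "(\<Sum>j<m. \<mu> i j * gs_vec B j $ c) = (\<Sum>j<Suc i. \<mu> i j * gs_vec B j $ c)"
      using i by (intro sum.mono_neutral_right) (auto simp: \<mu>_def)
    also have "\<dots> = gs_vec B i $ c + (\<Sum>j<i. gs_coeff B i j * gs_vec B j $ c)"
      by (simp add: \<mu>_def)
    finally show ?thesis
      using gs_vec_rec[of i B c] B i c by simp
  qed
  have "v $ c = (\<Sum>j<m. (\<Sum>i<m. y $ i * \<mu> i j) * gs_vec B j $ c)" if c: "c < n" for c
  proof -
    have "v $ c = (\<Sum>i<m. \<Sum>j<m. y $ i * \<mu> i j * gs_vec B j $ c)"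
      using y B c row
      by (auto simp: scalar_prod_def atLeast0LessThan sum_distrib_left mult_ac intro!: sum.cong)
    also have "\<dots> = (\<Sum>j<m. \<Sum>i<m. y $ i * \<mu> i j * gs_vec B j $ c)"
      by (rule sum.swap)
    finally show ?thesis by (simp add: sum_distrib_right)
  qed
  thus ?thesis by (intro exI[of _ "\<lambda>j. \<Sum>i<m. y $ i * \<mu> i j"]) auto
qed

text \<open>Some expansion exists by \<open>gs_vec_expand_row_space\<close>; pairing it with one
  Gram-Schmidt vector kills all other terms and so determines the coefficient.\<close>

lemma gs_vec_fourier:
  assumes B: "B \<in> carrier_mat m n" and ind: "lin_indep_rows B"
    and v: "v \<in> row_sp B" "v \<in> carrier_vec n" and c: "c < n"
  shows "v $ c = (\<Sum>j<m. (v \<bullet> gs_vec B j) / (gs_vec B j \<bullet> gs_vec B j) * gs_vec B j $ c)"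
proof -
  have g: "gs_vec B j \<in> carrier_vec n" if "j < m" for j
    using gs_vec_carrier[of j B] B that by auto
  obtain x where x: "\<And>c. c < n \<Longrightarrow> v $ c = (\<Sum>j<m. x j * gs_vec B j $ c)"
    using gs_vec_expand_row_space[OF B v(1)] by blast
  have "(v \<bullet> gs_vec B j) / (gs_vec B j \<bullet> gs_vec B j) = x j" if j: "j < m" for j
  proof -
    have "v \<bullet> gs_vec B j = gs_vec B j \<bullet> v"
      using comm_scalar_prod[OF v(2) g[OF j]] .
    also have "\<dots> = (\<Sum>l<m. x l * (gs_vec B j \<bullet> gs_vec B l))"
      using x g v(2) by (intro scalar_prod_expand_right[where n = n]) auto
    also have "\<dots> = (\<Sum>l<m. if l = j then x j * (gs_vec B j \<bullet> gs_vec B j) else 0)"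
      using gs_vec_orthogonal[OF ind] B j by (intro sum.cong) auto
    also have "\<dots> = x j * (gs_vec B j \<bullet> gs_vec B j)"
      using j by simp
    finally show ?thesis
      using gs_vec_orthogonal[OF ind, of j j] B j by simp
  qed
  thus ?thesis using x[OF c] by simp
qed

lemma scalar_prod_gs_vec_rec:
  assumes B: "B \<in> carrier_mat m n" and i: "i < m" and v: "v \<in> carrier_vec n"
  shows "v \<bullet> gs_vec B i = v \<bullet> row B i - (\<Sum>j<i. gs_coeff B i j * (v \<bullet> gs_vec B j))"
proof -
  define x where "x j = (if j = i then 1 else gs_coeff B i j)" for j
  have "v \<bullet> row B i = (\<Sum>j\<in>{..<Suc i}. x j * (v \<bullet> gs_vec B j))"
  proof (rule scalar_prod_expand_right[where n = n])
    show "row B i \<in> carrier_vec n" using B i by auto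
    show "gs_vec B j \<in> carrier_vec n" if "j \<in> {..<Suc i}" for j
      using that gs_vec_carrier[of j B] B i by auto
    show "row B i $ c = (\<Sum>j\<in>{..<Suc i}. x j * gs_vec B j $ c)" if "c < n" for c
      using gs_vec_rec[of i B c] B i that by (simp add: x_def)
  qed
  thus ?thesis by (simp add: x_def)
qed

section \<open>Pairings of dual rows with Gram-Schmidt vectors\<close>

lemma
  assumes "lin_indep_rows B"
  shows dual_matrix_carrier: "dual_matrix B \<in> carrier_mat (dim_row B) (dim_col B)"
    and row_sp_dual_matrix: "row_sp (dual_matrix B) = row_sp B"
    and mult_transpose_dual_matrix: "B * transpose_mat (dual_matrix B) = 1\<^sub>m (dim_row B)"
  using theI'[OF dual_ex1[OF assms]] unfolding dual_matrix_def by blast+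

lemma row_dual_matrix_in_row_sp:
  assumes ind: "lin_indep_rows B" and k: "k < dim_row B"
  shows "row (dual_matrix B) k \<in> row_sp B"
proof -
  interpret vec_space "TYPE(rat)" "dim_col B" .
  note D = dual_matrix_carrier[OF ind]
  have "set (rows (dual_matrix B)) \<subseteq> carrier_vec (dim_col B)"
    using D rows_carrier[of "dual_matrix B"] by auto
  moreover have "row (dual_matrix B) k \<in> set (rows (dual_matrix B))"
    using k D by (auto simp: rows_def)
  ultimately have "row (dual_matrix B) k \<in> row_space (dual_matrix B)"
    unfolding row_space_def using span_mem by blast
  thus ?thesis
    using row_sp_dual_matrix[OF ind] carrier_matD(2)[OF D] by metis
qed

lemma row_dual_matrix_scalar_prod_row:
  assumes ind: "lin_indep_rows B" and "k < dim_row B" "j < dim_row B"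
  shows "row (dual_matrix B) k \<bullet> row B j = (if j = k then 1 else 0)"
proof -
  note D = dual_matrix_carrier[OF ind]
  have "(B * transpose_mat (dual_matrix B)) $$ (j, k) = row B j \<bullet> row (dual_matrix B) k"
    using assms D by simp
  also have "\<dots> = row (dual_matrix B) k \<bullet> row B j"
    using assms D by (intro comm_scalar_prod[of _ "dim_col B"]) auto
  finally show ?thesis
    using assms by (simp add: mult_transpose_dual_matrix)
qed

text \<open>In the paired recursion the term with row \<open>j\<close> vanishes by duality, since
  \<open>j < k\<close>, and the earlier pairings vanish by induction.\<close>

lemma row_dual_matrix_scalar_prod_gs_vec_less:
  assumes ind: "lin_indep_rows B" and "k < dim_row B" "j < k"
  shows "row (dual_matrix B) k \<bullet> gs_vec B j = 0"
  using assms(3)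
proof (induction j rule: less_induct)
  case (less j)
  have "row (dual_matrix B) k \<in> carrier_vec (dim_col B)"
    using dual_matrix_carrier[OF ind] assms(2) by auto
  thus ?case
    using scalar_prod_gs_vec_rec[of B "dim_row B" "dim_col B" j "row (dual_matrix B) k"]
      row_dual_matrix_scalar_prod_row[OF ind assms(2), of j] less assms(2) by simp
qed

lemma row_dual_matrix_scalar_prod_gs_vec_same:
  assumes ind: "lin_indep_rows B" and k: "k < dim_row B"
  shows "row (dual_matrix B) k \<bullet> gs_vec B k = 1"
proof -
  have "row (dual_matrix B) k \<in> carrier_vec (dim_col B)"
    using dual_matrix_carrier[OF ind] k by auto
  thus ?thesis
    using scalar_prod_gs_vec_rec[of B "dim_row B" "dim_col B" k "row (dual_matrix B) k"]
      row_dual_matrix_scalar_prod_row[OF ind k k] k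
      row_dual_matrix_scalar_prod_gs_vec_less[OF ind k] by simp
qed

text \<open>Duality makes the term with row \<open>Suc k\<close> vanish, and in the subtracted sum
  only the index \<open>k\<close> survives, where the pairing is 1.\<close>

lemma row_dual_matrix_scalar_prod_gs_vec_Suc:
  assumes ind: "lin_indep_rows B" and k: "Suc k < dim_row B"
  shows "row (dual_matrix B) k \<bullet> gs_vec B (Suc k) = - gs_coeff B (Suc k) k"
proof -
  have k': "k < dim_row B" using k by simp
  have "row (dual_matrix B) k \<in> carrier_vec (dim_col B)"
    using dual_matrix_carrier[OF ind] k' by auto
  thus ?thesis
    using scalar_prod_gs_vec_rec[of B "dim_row B" "dim_col B" "Suc k" "row (dual_matrix B) k"]
      row_dual_matrix_scalar_prod_row[OF ind k' k] k
      row_dual_matrix_scalar_prod_gs_vec_less[OF ind k']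
      row_dual_matrix_scalar_prod_gs_vec_same[OF ind k'] by simp
qed

section \<open>The orthogonalization of the reversed dual\<close>

text \<open>In the reversed order \<open>g\<close> the expansion of a dual row becomes triangular.
  Normalizing by \<open>g j \<bullet> g j\<close> leaves the bare pairings as coefficients, with 1
  on the diagonal, so \<open>gs_unique\<close> applies.\<close>

lemma gs_reverse_dual:
  assumes B: "B \<in> carrier_mat m n" and ind: "lin_indep_rows B" and i: "i < m"
  defines "C \<equiv> reverse_rows (dual_matrix B)"
    and "g \<equiv> \<lambda>i. gs_vec B (m - Suc i)"
  shows "gs_vec C i = (1 / (g i \<bullet> g i)) \<cdot>\<^sub>v g i \<and>
    (\<forall>j<i. gs_coeff C i j = row (dual_matrix B) (m - Suc i) \<bullet> g j)"
proof -
  let ?D = "dual_matrix B"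
  have D: "?D \<in> carrier_mat m n" using dual_matrix_carrier[OF ind] B by auto
  have C: "C \<in> carrier_mat m n" using D by (auto simp: C_def reverse_rows_def)
  have g: "g j \<in> carrier_vec n" if "j < m" for j
    using gs_vec_carrier[of "m - Suc j" B] B that by (auto simp: g_def)
  have orth: "g j \<bullet> g l = 0 \<longleftrightarrow> j \<noteq> l" if "j < m" "l < m" for j l
    using gs_vec_orthogonal[OF ind, of "m - Suc j" "m - Suc l"] B that by (auto simp: g_def)
  show ?thesis
  proof (rule gs_unique[OF C _ _ _ _ i])
    show "(1 / (g i \<bullet> g i)) \<cdot>\<^sub>v g i \<in> carrier_vec n" if "i < m" for i
      using g[OF that] by simp
    show "((1 / (g i \<bullet> g i)) \<cdot>\<^sub>v g i) \<bullet> ((1 / (g j \<bullet> g j)) \<cdot>\<^sub>v g j) = 0"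
      if "i < m" "j < m" "i \<noteq> j" for i j
      using that g[of i] g[of j] orth[of i j] by simp
    show "((1 / (g i \<bullet> g i)) \<cdot>\<^sub>v g i) \<bullet> ((1 / (g i \<bullet> g i)) \<cdot>\<^sub>v g i) \<noteq> 0" if "i < m" for i
      using that g[of i] orth[of i i] by simp
    fix i c assume i: "i < m" and c: "c < n"
    let ?k = "m - Suc i"
    let ?d = "row ?D ?k"
    have k: "?k < dim_row B" using B i by simp
    have d: "?d \<in> carrier_vec n" using D i by auto
    have less: "?d \<bullet> g j = 0" if "i < j" "j < m" for j
      using row_dual_matrix_scalar_prod_gs_vec_less[OF ind k, of "m - Suc j"] that
      by (auto simp: g_def)
    have same: "?d \<bullet> g i = 1"
      using row_dual_matrix_scalar_prod_gs_vec_same[OF ind k] by (simp add: g_def)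
    have "row C i = ?d"
      using D d i mat_of_rows_row[of i "rev (rows ?D)" n]
      by (simp add: C_def reverse_rows_def rev_nth)
    hence "row C i $ c = (\<Sum>j<m. (?d \<bullet> gs_vec B j) / (gs_vec B j \<bullet> gs_vec B j) * gs_vec B j $ c)"
      using gs_vec_fourier[OF B ind row_dual_matrix_in_row_sp[OF ind k] d c] by simp
    also have "\<dots> = (\<Sum>j<m. (?d \<bullet> g j) / (g j \<bullet> g j) * g j $ c)"
      unfolding g_def by (rule sum.nat_diff_reindex[symmetric])
    \<comment> \<open>A reversed index \<open>j > i\<close> is an original index below
      \<open>?k\<close>, where the pairing is 0.\<close>
    also have "\<dots> = (\<Sum>j<Suc i. (?d \<bullet> g j) / (g j \<bullet> g j) * g j $ c)"
      using i less by (intro sum.mono_neutral_right) auto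
    also have "\<dots> = (\<Sum>j<Suc i. (?d \<bullet> g j) * ((1 / (g j \<bullet> g j)) \<cdot>\<^sub>v g j) $ c)"
    proof (rule sum.cong)
      fix j assume "j \<in> {..<Suc i}"
      thus "(?d \<bullet> g j) / (g j \<bullet> g j) * g j $ c = (?d \<bullet> g j) * ((1 / (g j \<bullet> g j)) \<cdot>\<^sub>v g j) $ c"
        using g[of j] i c by simp
    qed simp
    finally show "row C i $ c = ((1 / (g i \<bullet> g i)) \<cdot>\<^sub>v g i) $ c +
        (\<Sum>j<i. (?d \<bullet> g j) * ((1 / (g j \<bullet> g j)) \<cdot>\<^sub>v g j) $ c)"
      by (simp add: same)
  qed
qed

text \<open>With \<open>k = m - Suc (Suc i)\<close>, the coefficient is the pairing of dual row
  \<open>k\<close> with \<open>gs_vec B (Suc k)\<close>, so reversal sends subdiagonal positions to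
  subdiagonal positions.\<close>

lemma gs_coeff_reverse_dual_Suc:
  assumes B: "B \<in> carrier_mat m n" and ind: "lin_indep_rows B" and i: "Suc i < m"
  shows "gs_coeff (reverse_rows (dual_matrix B)) (Suc i) i
    = - gs_coeff B (m - Suc i) (m - Suc (Suc i))"
proof -
  have "m - Suc i = Suc (m - Suc (Suc i))" using i by simp
  thus ?thesis
    using gs_reverse_dual[OF B ind i] B i
      row_dual_matrix_scalar_prod_gs_vec_Suc[OF ind, of "m - Suc (Suc i)"] by simp
qed

lemma euclid_norm_power2: "(euclid_norm v)\<^sup>2 = of_rat (v \<bullet> v)"
proof -
  have "0 \<le> v \<bullet> v" by (auto simp: scalar_prod_def intro: sum_nonneg)
  thus ?thesis by (simp add: euclid_norm_def)
qed

text \<open>Dividing a vector by its squared norm inverts that squared norm.\<close>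

lemma euclid_norm_gs_reverse_dual:
  assumes B: "B \<in> carrier_mat m n" and ind: "lin_indep_rows B" and i: "i < m"
  shows "(euclid_norm (gs_vec (reverse_rows (dual_matrix B)) i))\<^sup>2
    = 1 / (euclid_norm (gs_vec B (m - Suc i)))\<^sup>2"
proof -
  have "gs_vec B (m - Suc i) \<in> carrier_vec n"
    using gs_vec_carrier[of "m - Suc i" B] B i by auto
  thus ?thesis
    using gs_reverse_dual[OF B ind i]
    by (simp add: euclid_norm_power2 of_rat_divide of_rat_mult)
qed

lemma euclid_norm_gs_vec_pos:
  assumes "lin_indep_rows B" "i < dim_row B"
  shows "0 < (euclid_norm (gs_vec B i))\<^sup>2"
  using gs_vec_orthogonal[OF assms(1) assms(2) assms(2)]
  by (simp add: zero_less_power2 euclid_norm_def)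

theorem theorem11:
  fixes B :: "rat mat" and L :: "rat vec set" and m n :: nat and \<delta> :: real
  assumes "B \<in> carrier_mat m n"
    and "basis_matrix B L"
    and "1 / 4 < \<delta>" and "\<delta> < 1"
  shows "(size_reduced B \<longrightarrow>
            (\<forall>i. i + 1 < m \<longrightarrow>
               \<bar>gs_coeff (reverse_rows (dual_matrix B)) (i + 1) i\<bar> \<le> 1 / 2))
       \<and> (lovasz \<delta> B \<longrightarrow> lovasz \<delta> (reverse_rows (dual_matrix B)))"
proof (intro conjI impI allI)
  note B = assms(1)
  have ind: "lin_indep_rows B" using assms(2) by (simp add: basis_matrix_def)
  let ?C = "reverse_rows (dual_matrix B)"
  {
    fix i assume "size_reduced B" "i + 1 < m"
    thus "\<bar>gs_coeff ?C (i + 1) i\<bar> \<le> 1 / 2"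
      \<comment> \<open>The absolute value removes the sign, leaving a subdiagonal instance of size
        reduction.\<close>
      using gs_coeff_reverse_dual_Suc[OF B ind, of i] B by (simp add: size_reduced_def)
  next
    assume lov: "lovasz \<delta> B"
    show "lovasz \<delta> ?C"
      unfolding lovasz_def
    proof (intro allI impI)
      fix i assume "i + 1 < dim_row ?C"
      hence i: "Suc i < m"
        using dual_matrix_carrier[OF ind] B by (simp add: reverse_rows_def)
      \<comment> \<open>Reversal sends \<open>i\<close> to \<open>Suc k\<close> and
        \<open>Suc i\<close> to \<open>k\<close>, so the two norms trade places.\<close>
      define k where "k = m - Suc (Suc i)"
      have k: "m - Suc i = Suc k" "Suc k < m" using i by (auto simp: k_def)
      define a N N' where "a = real_of_rat (gs_coeff B (Suc k) k)"
        and "N = (euclid_norm (gs_vec B k))\<^sup>2" and "N' = (euclid_norm (gs_vec B (Suc k)))\<^sup>2"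
      have pos: "0 < N" "0 < N'"
        using euclid_norm_gs_vec_pos[OF ind] B k by (auto simp: N_def N'_def)
      have "\<delta> * N \<le> a\<^sup>2 * N + N'"
        using lov B k unfolding lovasz_def a_def N_def N'_def by auto
      \<comment> \<open>Division by \<open>N * N'\<close> gives the inequality for the inverted
        norms, with \<open>1 / N'\<close> now the leading one.\<close>
      hence "\<delta> * (1 / N') \<le> a\<^sup>2 * (1 / N') + 1 / N"
        using pos by (simp add: field_simps)
      moreover have "(euclid_norm (gs_vec ?C i))\<^sup>2 = 1 / N'"
        using euclid_norm_gs_reverse_dual[OF B ind, of i] i k by (simp add: N'_def)
      moreover have "(euclid_norm (gs_vec ?C (Suc i)))\<^sup>2 = 1 / N"
        using euclid_norm_gs_reverse_dual[OF B ind i] by (simp add: N_def k_def)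
      moreover have "(of_rat (gs_coeff ?C (Suc i) i))\<^sup>2 = a\<^sup>2"
        using gs_coeff_reverse_dual_Suc[OF B ind i] k
        by (simp add: a_def k_def of_rat_minus)
      ultimately show "\<delta> * (euclid_norm (gs_vec ?C i))\<^sup>2
          \<le> (of_rat (gs_coeff ?C (i + 1) i))\<^sup>2 * (euclid_norm (gs_vec ?C i))\<^sup>2
            + (euclid_norm (gs_vec ?C (i + 1)))\<^sup>2"
        by simp
    qed
  }
qed

end
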